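(* Let $\mathscr{E}$ be a topos such that for every ring object $A$, right $A$-module $M$ and left $A$-module $N$ the functor $\mathrm{Ab}(\mathscr{E})\to\mathrm{Ab}$, $P\mapsto\mathrm{Hom}_A(M,[N,P]_{\mathbf Z})$ is representable. Let $A$ be a ring object in $\mathscr{E}$, $M$ a right $A$-module, $N$ a left $A$-module and $P\in\mathrm{Ab}(\mathscr{E})$. Given group homomorphisms $f,g:M\otimes_AN\to P$, $$f=g\iff\ \vDash\forall m{:}M,\,n{:}N\,\big(f(m\otimes n)=g(m\otimes n)\big).$$
   Context: $\mathrm{Ab}(\mathscr{E})$ is the category of abelian group objects in $\mathscr{E}$ and $\mathrm{Hom}_{\mathbf Z}$ its hom-groups. $\vDash\varphi$ means that the formula $\varphi$ of the internal (Mitchell–Bénabou) language is valid in $\mathscr{E}$. For abelian group objects $N,P$, $[N,P]_{\mathbf Z}$ is the subobject of the topos internal hom $[N,P]$ given internally by $\{f\mid\forall n,n'{:}N\,(f(n+n')=f(n)+f(n'))\}$; if $N$ is a left $A$-module it is a right $A$-module via $(fa)(n)=f(an)$. $M\otimes_AN\in\mathrm{Ab}(\mathscr{E})$ is the representing object: $\mathrm{Hom}_{\mathbf Z}(M\otimes_AN,P)\cong\mathrm{Hom}_A(M,[N,P]_{\mathbf Z})$, naturally in $P$. The morphism $\otimes:M\times N\to M\otimes_AN$ is the transpose of the unit $\eta_M:M\to[N,M\otimes_AN]_{\mathbf Z}\rightarrowtail[N,M\otimes_AN]$, and $m\otimes n$ denotes the term $\otimes(m,n)$ of type $M\otimes_AN$.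 *)

theory Defs
  imports "HOL-Algebra.Group"
begin

section \<open>Categories and elementary toposes\<close>

text \<open>\<open>g \<cdot> f\<close> is composition in the usual order, ``\<open>g\<close> after \<open>f\<close>''.\<close>

record ('o, 'a) cat =
  Obj :: "'o set"
  Arr :: "'a set"
  Dom :: "'a \<Rightarrow> 'o"
  Cod :: "'a \<Rightarrow> 'o"
  Idt :: "'o \<Rightarrow> 'a"
  Comp :: "'a \<Rightarrow> 'a \<Rightarrow> 'a"  (infixr "\<cdot>\<index>" 70)

definition Hom :: "('o, 'a, 'z) cat_scheme \<Rightarrow> 'o \<Rightarrow> 'o \<Rightarrow> 'a set" where
  "Hom C X Y = {f \<in> Arr C. Dom C f = X \<and> Cod C f = Y}"

locale category =
  fixes C :: "('o, 'a, 'z) cat_scheme" (structure)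
  assumes Dom_Obj: "f \<in> Arr C \<Longrightarrow> Dom C f \<in> Obj C"
    and Cod_Obj: "f \<in> Arr C \<Longrightarrow> Cod C f \<in> Obj C"
    and Idt_Hom: "X \<in> Obj C \<Longrightarrow> Idt C X \<in> Hom C X X"
    and Comp_Hom: "f \<in> Hom C X Y \<Longrightarrow> g \<in> Hom C Y Z \<Longrightarrow> g \<cdot> f \<in> Hom C X Z"
    and Comp_Idt: "f \<in> Hom C X Y \<Longrightarrow> f \<cdot> Idt C X = f"
    and Idt_Comp: "f \<in> Hom C X Y \<Longrightarrow> Idt C Y \<cdot> f = f"
    and Comp_assoc: "f \<in> Hom C W X \<Longrightarrow> g \<in> Hom C X Y \<Longrightarrow> h \<in> Hom C Y Z
                       \<Longrightarrow> (h \<cdot> g) \<cdot> f = h \<cdot> (g \<cdot> f)"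

definition monic :: "('o, 'a, 'z) cat_scheme \<Rightarrow> 'a \<Rightarrow> bool" where
  "monic C m \<longleftrightarrow> m \<in> Arr C \<and>
     (\<forall>W. \<forall>h \<in> Hom C W (Dom C m). \<forall>k \<in> Hom C W (Dom C m).
        m \<cdot>\<^bsub>C\<^esub> h = m \<cdot>\<^bsub>C\<^esub> k \<longrightarrow> h = k)"

text \<open>\<open>is_pullback C p q f g\<close>: the square with \<open>f \<cdot> p = g \<cdot> q\<close> is a pullback
  of the cospan \<open>f, g\<close>.\<close>

definition is_pullback :: "('o, 'a, 'z) cat_scheme \<Rightarrow> 'a \<Rightarrow> 'a \<Rightarrow> 'a \<Rightarrow> 'a \<Rightarrow> bool" where
  "is_pullback C p q f g \<longleftrightarrow>
     f \<in> Arr C \<and> g \<in> Arr C \<and> Cod C f = Cod C g \<and>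
     p \<in> Hom C (Dom C p) (Dom C f) \<and> q \<in> Hom C (Dom C p) (Dom C g) \<and>
     f \<cdot>\<^bsub>C\<^esub> p = g \<cdot>\<^bsub>C\<^esub> q \<and>
     (\<forall>W. \<forall>h \<in> Hom C W (Dom C f). \<forall>k \<in> Hom C W (Dom C g).
        f \<cdot>\<^bsub>C\<^esub> h = g \<cdot>\<^bsub>C\<^esub> k \<longrightarrow>
        (\<exists>!u. u \<in> Hom C W (Dom C p) \<and> p \<cdot>\<^bsub>C\<^esub> u = h \<and> q \<cdot>\<^bsub>C\<^esub> u = k))"

text \<open>Topos structure with a choice of terminal object, binary products, internal homs
  and subobject classifier. \<open>Inh E X Y\<close> is the internal hom \<open>[X,Y]\<close>, and
  \<open>Ev E X Y : [X,Y] \<times> X \<rightarrow> Y\<close> is evaluation.\<close>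

record ('o, 'a) topos_data = "('o, 'a) cat" +
  One :: 'o
  Prod :: "'o \<Rightarrow> 'o \<Rightarrow> 'o"  (infixl "\<^bold>\<times>\<index>" 75)
  Fst :: "'o \<Rightarrow> 'o \<Rightarrow> 'a"
  Snd :: "'o \<Rightarrow> 'o \<Rightarrow> 'a"
  Inh :: "'o \<Rightarrow> 'o \<Rightarrow> 'o"
  Ev :: "'o \<Rightarrow> 'o \<Rightarrow> 'a"
  Omega :: 'o
  Tru :: 'a

context
  fixes E :: "('o, 'a) topos_data" (structure)
begin

definition bang :: "'o \<Rightarrow> 'a" where
  "bang X = (THE u. u \<in> Hom E X (One E))"

definition pairing :: "'a \<Rightarrow> 'a \<Rightarrow> 'a" where
  "pairing f g = (THE h. h \<in> Hom E (Dom E f) (Cod E f \<^bold>\<times> Cod E g) \<and>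
     Fst E (Cod E f) (Cod E g) \<cdot> h = f \<and> Snd E (Cod E f) (Cod E g) \<cdot> h = g)"

definition prod_map :: "'a \<Rightarrow> 'a \<Rightarrow> 'a" where
  "prod_map f g = pairing (f \<cdot> Fst E (Dom E f) (Dom E g)) (g \<cdot> Snd E (Dom E f) (Dom E g))"

text \<open>\<open>curry_arr Z X f : Z \<rightarrow> [X,Y]\<close> is the transpose of \<open>f : Z \<times> X \<rightarrow> Y\<close>, and
  \<open>uncurry_arr X Y h : Z \<times> X \<rightarrow> Y\<close> that of \<open>h : Z \<rightarrow> [X,Y]\<close>.\<close>

definition uncurry_arr :: "'o \<Rightarrow> 'o \<Rightarrow> 'a \<Rightarrow> 'a" where
  "uncurry_arr X Y h = Ev E X Y \<cdot> prod_map h (Idt E X)"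

definition curry_arr :: "'o \<Rightarrow> 'o \<Rightarrow> 'a \<Rightarrow> 'a" where
  "curry_arr Z X f = (THE h. h \<in> Hom E Z (Inh E X (Cod E f)) \<and> uncurry_arr X (Cod E f) h = f)"

definition classifies :: "'a \<Rightarrow> 'a \<Rightarrow> bool" where
  "classifies c m \<longleftrightarrow> c \<in> Hom E (Cod E m) (Omega E) \<and> is_pullback E m (bang (Dom E m)) c (Tru E)"

definition char_arr :: "'a \<Rightarrow> 'a" where
  "char_arr m = (THE c. classifies c m)"

definition subobject_arr :: "'a \<Rightarrow> 'a" where
  "subobject_arr c = (SOME m. monic E m \<and> classifies c m)"

definition factor_through :: "'a \<Rightarrow> 'a \<Rightarrow> 'a" where
  "factor_through m h = (THE k. k \<in> Hom E (Dom E h) (Dom E m) \<and> m \<cdot> k = h)"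

end

locale topos = category E for E :: "('o, 'a) topos_data" (structure) +
  assumes One_Obj: "One E \<in> Obj E"
    and terminal: "X \<in> Obj E \<Longrightarrow> \<exists>!u. u \<in> Hom E X (One E)"
    and Prod_Obj: "X \<in> Obj E \<Longrightarrow> Y \<in> Obj E \<Longrightarrow> X \<^bold>\<times> Y \<in> Obj E"
    and Fst_Hom: "X \<in> Obj E \<Longrightarrow> Y \<in> Obj E \<Longrightarrow> Fst E X Y \<in> Hom E (X \<^bold>\<times> Y) X"
    and Snd_Hom: "X \<in> Obj E \<Longrightarrow> Y \<in> Obj E \<Longrightarrow> Snd E X Y \<in> Hom E (X \<^bold>\<times> Y) Y"
    and product: "f \<in> Hom E W X \<Longrightarrow> g \<in> Hom E W Y \<Longrightarrow>
           \<exists>!h. h \<in> Hom E W (X \<^bold>\<times> Y) \<and> Fst E X Y \<cdot> h = f \<and> Snd E X Y \<cdot> h = g"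
    and pullbacks: "f \<in> Hom E X Z \<Longrightarrow> g \<in> Hom E Y Z \<Longrightarrow> \<exists>p q. is_pullback E p q f g"
    and Inh_Obj: "X \<in> Obj E \<Longrightarrow> Y \<in> Obj E \<Longrightarrow> Inh E X Y \<in> Obj E"
    and Ev_Hom: "X \<in> Obj E \<Longrightarrow> Y \<in> Obj E \<Longrightarrow> Ev E X Y \<in> Hom E (Inh E X Y \<^bold>\<times> X) Y"
    and exponential: "X \<in> Obj E \<Longrightarrow> Y \<in> Obj E \<Longrightarrow> Z \<in> Obj E \<Longrightarrow> f \<in> Hom E (Z \<^bold>\<times> X) Y \<Longrightarrow>
           \<exists>!h. h \<in> Hom E Z (Inh E X Y) \<and> uncurry_arr E X Y h = f"
    and Omega_Obj: "Omega E \<in> Obj E"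
    and Tru_Hom: "Tru E \<in> Hom E (One E) (Omega E)"
    and classifier: "monic E m \<Longrightarrow> \<exists>!c. classifies E c m"


section \<open>The Mitchell--Benabou language\<close>

text \<open>Types are objects; a variable bound by \<open>TLam\<close> or \<open>TAll\<close> carries its type.
  \<open>TApp h t\<close> applies an arrow \<open>h\<close> of the topos. This covers every other operation of the
  language: the connectives are arrows \<open>\<Omega> \<times> \<Omega> \<rightarrow> \<Omega>\<close>, application and membership are
  evaluation arrows, set comprehension is \<open>TLam\<close> with a body of type \<open>\<Omega>\<close>, and the
  existential quantifier is an arrow \<open>[X,\<Omega>] \<rightarrow> \<Omega>\<close> applied to a comprehension.\<close>

datatype ('o, 'a) tm =
    TVar string
  | TStar
  | TPair "('o, 'a) tm" "('o, 'a) tm"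
  | TApp 'a "('o, 'a) tm"
  | TLam string 'o "('o, 'a) tm"
  | TEq "('o, 'a) tm" "('o, 'a) tm"
  | TAll string 'o "('o, 'a) tm"

context
  fixes E :: "('o, 'a) topos_data" (structure)
begin

text \<open>A context lists the innermost variable first; it is interpreted as
  \<open>((1 \<times> X\<^sub>n) \<times> \<dots>) \<times> X\<^sub>1\<close>.\<close>

fun ctx_obj :: "(string \<times> 'o) list \<Rightarrow> 'o" where
  "ctx_obj [] = One E"
| "ctx_obj ((x, X) # \<Gamma>) = ctx_obj \<Gamma> \<^bold>\<times> X"

fun var_arr :: "(string \<times> 'o) list \<Rightarrow> string \<Rightarrow> 'a" where
  "var_arr [] x = undefined"
| "var_arr ((y, Y) # \<Gamma>) x =
     (if x = y then Snd E (ctx_obj \<Gamma>) Y else var_arr \<Gamma> x \<cdot> Fst E (ctx_obj \<Gamma>) Y)"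

definition eq_arr :: "'o \<Rightarrow> 'a" where
  "eq_arr Y = char_arr E (pairing E (Idt E Y) (Idt E Y))"

text \<open>\<open>\<forall>\<^sub>X : [X,\<Omega>] \<rightarrow> \<Omega>\<close> classifies the name \<open>1 \<rightarrow> [X,\<Omega>]\<close> of the maximal subobject.\<close>

definition all_arr :: "'o \<Rightarrow> 'a" where
  "all_arr X = char_arr E (curry_arr E (One E) X (Tru E \<cdot> bang E (One E \<^bold>\<times> X)))"

fun interp :: "(string \<times> 'o) list \<Rightarrow> ('o, 'a) tm \<Rightarrow> 'a" where
  "interp \<Gamma> (TVar x) = var_arr \<Gamma> x"
| "interp \<Gamma> TStar = bang E (ctx_obj \<Gamma>)"
| "interp \<Gamma> (TPair s t) = pairing E (interp \<Gamma> s) (interp \<Gamma> t)"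
| "interp \<Gamma> (TApp h t) = h \<cdot> interp \<Gamma> t"
| "interp \<Gamma> (TLam x X t) = curry_arr E (ctx_obj \<Gamma>) X (interp ((x, X) # \<Gamma>) t)"
| "interp \<Gamma> (TEq s t) = eq_arr (Cod E (interp \<Gamma> s)) \<cdot> pairing E (interp \<Gamma> s) (interp \<Gamma> t)"
| "interp \<Gamma> (TAll x X p) = all_arr X \<cdot> curry_arr E (ctx_obj \<Gamma>) X (interp ((x, X) # \<Gamma>) p)"

definition valid :: "('o, 'a) tm \<Rightarrow> bool" where
  "valid p \<longleftrightarrow> interp [] p = Tru E"

text \<open>A term in one or two variables as an arrow \<open>X \<rightarrow> Z\<close> or \<open>X \<times> Y \<rightarrow> Z\<close>; the pairing removes
  the leading factor \<open>1\<close> of the context.\<close>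

definition arr1 :: "string \<Rightarrow> 'o \<Rightarrow> ('o, 'a) tm \<Rightarrow> 'a" where
  "arr1 x X t = interp [(x, X)] t \<cdot> pairing E (bang E X) (Idt E X)"

definition arr2 :: "string \<Rightarrow> 'o \<Rightarrow> string \<Rightarrow> 'o \<Rightarrow> ('o, 'a) tm \<Rightarrow> 'a" where
  "arr2 x X y Y t = interp [(y, Y), (x, X)] t \<cdot>
     pairing E (pairing E (bang E (X \<^bold>\<times> Y)) (Fst E X Y)) (Snd E X Y)"

text \<open>The monomorphism \<open>{x : X | p} \<rightarrow> X\<close>.\<close>

definition compr :: "string \<Rightarrow> 'o \<Rightarrow> ('o, 'a) tm \<Rightarrow> 'a" where
  "compr x X p = subobject_arr E (arr1 x X p)"

text \<open>Equality of the arrows denoted by two terms in context, i.e. commutativity of the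
  diagram expressing the equation.\<close>

definition eqn :: "(string \<times> 'o) list \<Rightarrow> ('o, 'a) tm \<Rightarrow> ('o, 'a) tm \<Rightarrow> bool" where
  "eqn \<Gamma> s t \<longleftrightarrow> interp \<Gamma> s = interp \<Gamma> t"

end


section \<open>Abelian group objects, ring objects, modules\<close>

record ('o, 'a) abgrp =
  gobj :: 'o
  gadd :: 'a
  gzero :: 'a
  gneg :: 'a

record ('o, 'a) ringo = "('o, 'a) abgrp" +
  rmul :: 'a
  rone :: 'a

record ('o, 'a) modo = "('o, 'a) abgrp" +
  act :: 'a

text \<open>In the modules below, \<open>act\<close> is an arrow \<open>M \<times> A \<rightarrow> M\<close> for right modules and
  \<open>A \<times> N \<rightarrow> N\<close> for left modules.\<close>

abbreviation plus_tm :: "('o, 'a, 'z) abgrp_scheme \<Rightarrow> ('o, 'a) tm \<Rightarrow> ('o, 'a) tm \<Rightarrow> ('o, 'a) tm" where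
  "plus_tm G s t \<equiv> TApp (gadd G) (TPair s t)"

abbreviation zero_tm :: "('o, 'a, 'z) abgrp_scheme \<Rightarrow> ('o, 'a) tm" where
  "zero_tm G \<equiv> TApp (gzero G) TStar"

abbreviation neg_tm :: "('o, 'a, 'z) abgrp_scheme \<Rightarrow> ('o, 'a) tm \<Rightarrow> ('o, 'a) tm" where
  "neg_tm G t \<equiv> TApp (gneg G) t"

abbreviation mul_tm :: "('o, 'a, 'z) ringo_scheme \<Rightarrow> ('o, 'a) tm \<Rightarrow> ('o, 'a) tm \<Rightarrow> ('o, 'a) tm" where
  "mul_tm A s t \<equiv> TApp (rmul A) (TPair s t)"

abbreviation one_tm :: "('o, 'a, 'z) ringo_scheme \<Rightarrow> ('o, 'a) tm" where
  "one_tm A \<equiv> TApp (rone A) TStar"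

abbreviation act_tm :: "('o, 'a, 'z) modo_scheme \<Rightarrow> ('o, 'a) tm \<Rightarrow> ('o, 'a) tm \<Rightarrow> ('o, 'a) tm" where
  "act_tm M s t \<equiv> TApp (act M) (TPair s t)"

context
  fixes E :: "('o, 'a) topos_data" (structure)
begin

definition abgrp_obj :: "('o, 'a, 'z) abgrp_scheme \<Rightarrow> bool" where
  "abgrp_obj G \<longleftrightarrow>
     gobj G \<in> Obj E \<and>
     gadd G \<in> Hom E (gobj G \<^bold>\<times> gobj G) (gobj G) \<and>
     gzero G \<in> Hom E (One E) (gobj G) \<and>
     gneg G \<in> Hom E (gobj G) (gobj G) \<and>
     (let \<Gamma> = [(''z'', gobj G), (''y'', gobj G), (''x'', gobj G)];
          x = TVar ''x''; y = TVar ''y''; z = TVar ''z'' in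
        eqn E \<Gamma> (plus_tm G (plus_tm G x y) z) (plus_tm G x (plus_tm G y z)) \<and>
        eqn E \<Gamma> (plus_tm G x y) (plus_tm G y x) \<and>
        eqn E \<Gamma> (plus_tm G x (zero_tm G)) x \<and>
        eqn E \<Gamma> (plus_tm G x (neg_tm G x)) (zero_tm G))"

definition ring_obj :: "('o, 'a, 'z) ringo_scheme \<Rightarrow> bool" where
  "ring_obj A \<longleftrightarrow>
     abgrp_obj A \<and>
     rmul A \<in> Hom E (gobj A \<^bold>\<times> gobj A) (gobj A) \<and>
     rone A \<in> Hom E (One E) (gobj A) \<and>
     (let \<Gamma> = [(''c'', gobj A), (''b'', gobj A), (''a'', gobj A)];
          a = TVar ''a''; b = TVar ''b''; c = TVar ''c'' in
        eqn E \<Gamma> (mul_tm A (mul_tm A a b) c) (mul_tm A a (mul_tm A b c)) \<and>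
        eqn E \<Gamma> (mul_tm A a (one_tm A)) a \<and>
        eqn E \<Gamma> (mul_tm A (one_tm A) a) a \<and>
        eqn E \<Gamma> (mul_tm A a (plus_tm A b c)) (plus_tm A (mul_tm A a b) (mul_tm A a c)) \<and>
        eqn E \<Gamma> (mul_tm A (plus_tm A a b) c) (plus_tm A (mul_tm A a c) (mul_tm A b c)))"

definition right_module :: "('o, 'a, 'y) ringo_scheme \<Rightarrow> ('o, 'a, 'z) modo_scheme \<Rightarrow> bool" where
  "right_module A M \<longleftrightarrow>
     abgrp_obj M \<and>
     act M \<in> Hom E (gobj M \<^bold>\<times> gobj A) (gobj M) \<and>
     (let \<Gamma> = [(''b'', gobj A), (''a'', gobj A), (''y'', gobj M), (''x'', gobj M)];
          x = TVar ''x''; y = TVar ''y''; a = TVar ''a''; b = TVar ''b'' in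
        eqn E \<Gamma> (act_tm M (plus_tm M x y) a) (plus_tm M (act_tm M x a) (act_tm M y a)) \<and>
        eqn E \<Gamma> (act_tm M x (plus_tm A a b)) (plus_tm M (act_tm M x a) (act_tm M x b)) \<and>
        eqn E \<Gamma> (act_tm M (act_tm M x a) b) (act_tm M x (mul_tm A a b)) \<and>
        eqn E \<Gamma> (act_tm M x (one_tm A)) x)"

definition left_module :: "('o, 'a, 'y) ringo_scheme \<Rightarrow> ('o, 'a, 'z) modo_scheme \<Rightarrow> bool" where
  "left_module A N \<longleftrightarrow>
     abgrp_obj N \<and>
     act N \<in> Hom E (gobj A \<^bold>\<times> gobj N) (gobj N) \<and>
     (let \<Gamma> = [(''b'', gobj A), (''a'', gobj A), (''y'', gobj N), (''x'', gobj N)];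
          x = TVar ''x''; y = TVar ''y''; a = TVar ''a''; b = TVar ''b'' in
        eqn E \<Gamma> (act_tm N a (plus_tm N x y)) (plus_tm N (act_tm N a x) (act_tm N a y)) \<and>
        eqn E \<Gamma> (act_tm N (plus_tm A a b) x) (plus_tm N (act_tm N a x) (act_tm N b x)) \<and>
        eqn E \<Gamma> (act_tm N a (act_tm N b x)) (act_tm N (mul_tm A a b) x) \<and>
        eqn E \<Gamma> (act_tm N (one_tm A) x) x)"

text \<open>The hom-groups \<open>Hom\<^sub>Z(G,H)\<close> and \<open>Hom\<^sub>A(M,M')\<close> (right modules) under pointwise addition.\<close>

definition HomZ :: "('o, 'a, 'y) abgrp_scheme \<Rightarrow> ('o, 'a, 'z) abgrp_scheme \<Rightarrow> 'a monoid" where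
  "HomZ G H = \<lparr>
     carrier = {u \<in> Hom E (gobj G) (gobj H). u \<cdot> gadd G = gadd H \<cdot> prod_map E u u},
     monoid.mult = (\<lambda>u v. gadd H \<cdot> pairing E u v),
     monoid.one = gzero H \<cdot> bang E (gobj G)\<rparr>"

definition HomA :: "('o, 'a, 'x) ringo_scheme \<Rightarrow> ('o, 'a, 'y) modo_scheme \<Rightarrow>
    ('o, 'a, 'z) modo_scheme \<Rightarrow> 'a monoid" where
  "HomA A M M' = (HomZ M M') \<lparr>
     carrier := {u \<in> carrier (HomZ M M'). u \<cdot> act M = act M' \<cdot> prod_map E u (Idt E (gobj A))}\<rparr>"


section \<open>The internal hom of additive maps and the tensor product\<close>

text \<open>The inclusion \<open>[N,P]\<^sub>Z \<rightarrow> [N,P]\<close> of the subobject of internally additive maps.\<close>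

definition add_incl :: "('o, 'a, 'y) abgrp_scheme \<Rightarrow> ('o, 'a, 'z) abgrp_scheme \<Rightarrow> 'a" where
  "add_incl N P =
     (let ap = (\<lambda>t. TApp (Ev E (gobj N) (gobj P)) (TPair (TVar ''f'') t)) in
      compr E ''f'' (Inh E (gobj N) (gobj P))
        (TAll ''n'' (gobj N) (TAll ''k'' (gobj N)
          (TEq (ap (plus_tm N (TVar ''n'') (TVar ''k'')))
               (plus_tm P (ap (TVar ''n'')) (ap (TVar ''k'')))))))"

text \<open>\<open>[N,P]\<^sub>Z\<close> with the pointwise group structure and the right action \<open>(f a)(n) = f (a n)\<close>,
  for a left module \<open>N\<close>. The operations land in \<open>[N,P]\<close> as given by the lambda terms and
  are then restricted along the inclusion.\<close>

definition add_hom :: "('o, 'a, 'x) ringo_scheme \<Rightarrow> ('o, 'a, 'y) modo_scheme \<Rightarrow>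
    ('o, 'a, 'z) abgrp_scheme \<Rightarrow> ('o, 'a) modo" where
  "add_hom A N P =
     (let i = add_incl N P; H = Dom E i;
          ap = (\<lambda>f t. TApp (Ev E (gobj N) (gobj P)) (TPair (TApp i f) t));
          f = TVar ''f''; g = TVar ''g''; n = TVar ''n'';
          lam = TLam ''n'' (gobj N) in
      \<lparr> gobj = H,
        gadd = factor_through E i
                 (arr2 E ''f'' H ''g'' H (lam (plus_tm P (ap f n) (ap g n)))),
        gzero = factor_through E i (interp E [] (lam (zero_tm P))),
        gneg = factor_through E i (arr1 E ''f'' H (lam (neg_tm P (ap f n)))),
        act = factor_through E i
                (arr2 E ''f'' H ''a'' (gobj A) (lam (ap f (act_tm N (TVar ''a'') n))))\<rparr>)"

text \<open>The arrow \<open>[N,u]\<^sub>Z : [N,P]\<^sub>Z \<rightarrow> [N,P']\<^sub>Z\<close> induced by a homomorphism \<open>u : P \<rightarrow> P'\<close>.\<close>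

definition add_hom_map :: "('o, 'a, 'x) abgrp_scheme \<Rightarrow> ('o, 'a, 'y) abgrp_scheme \<Rightarrow>
    ('o, 'a, 'z) abgrp_scheme \<Rightarrow> 'a \<Rightarrow> 'a" where
  "add_hom_map N P P' u =
     (let i = add_incl N P; H = Dom E i in
      factor_through E (add_incl N P')
        (arr1 E ''f'' H (TLam ''n'' (gobj N)
          (TApp u (TApp (Ev E (gobj N) (gobj P)) (TPair (TApp i (TVar ''f'')) (TVar ''n'')))))))"

text \<open>\<open>T\<close> together with the natural isomorphism \<open>\<Phi>\<^sub>P : Hom\<^sub>Z(T,P) \<cong> Hom\<^sub>A(M,[N,P]\<^sub>Z)\<close> of
  \<open>Ab\<close>-valued functors represents \<open>P \<mapsto> Hom\<^sub>A(M,[N,P]\<^sub>Z)\<close>; that is, \<open>T\<close> is a tensor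
  product of \<open>M\<close> and \<open>N\<close> over \<open>A\<close>.\<close>

definition is_tensor :: "('o, 'a) ringo \<Rightarrow> ('o, 'a) modo \<Rightarrow> ('o, 'a) modo \<Rightarrow>
    ('o, 'a) abgrp \<Rightarrow> (('o, 'a) abgrp \<Rightarrow> 'a \<Rightarrow> 'a) \<Rightarrow> bool" where
  "is_tensor A M N T \<Phi> \<longleftrightarrow>
     abgrp_obj T \<and>
     (\<forall>P. abgrp_obj P \<longrightarrow> \<Phi> P \<in> iso (HomZ T P) (HomA A M (add_hom A N P))) \<and>
     (\<forall>P P' u v. abgrp_obj P \<longrightarrow> abgrp_obj P' \<longrightarrow>
        u \<in> carrier (HomZ P P') \<longrightarrow> v \<in> carrier (HomZ T P) \<longrightarrow>
        \<Phi> P' (u \<cdot> v) = add_hom_map N P P' u \<cdot> \<Phi> P v)"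

text \<open>\<open>\<otimes> : M \<times> N \<rightarrow> T\<close> is the transpose of the unit \<open>\<eta> = \<Phi>\<^sub>T(id) : M \<rightarrow> [N,T]\<^sub>Z\<close> followed by
  the inclusion into \<open>[N,T]\<close>.\<close>

definition tensor_arr :: "('o, 'a) modo \<Rightarrow> ('o, 'a) abgrp \<Rightarrow> (('o, 'a) abgrp \<Rightarrow> 'a \<Rightarrow> 'a) \<Rightarrow> 'a" where
  "tensor_arr N T \<Phi> =
     uncurry_arr E (gobj N) (gobj T) (add_incl N T \<cdot> \<Phi> T (Idt E (gobj T)))"

end

end

theory Submission
  imports Defs
begin

text \<open>By naturality, \<open>\<Phi>\<^sub>P(f) = [N,f]\<^sub>Z \<cdot> \<eta>\<close>, whose transpose \<open>M \<times> N \<rightarrow> P\<close> is \<open>f \<cdot> \<otimes>\<close>. As \<open>\<Phi>\<^sub>P\<close>,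
  the inclusion \<open>[N,P]\<^sub>Z \<rightarrow> [N,P]\<close> and transposition are injective, \<open>f\<close> is determined by
  \<open>f \<cdot> \<otimes>\<close>; and by Kripke--Joyal semantics the formula says that \<open>f \<cdot> \<otimes>\<close> and \<open>g \<cdot> \<otimes>\<close> agree on all
  generalized elements of \<open>M \<times> N\<close>.\<close>

section \<open>Calculus of arrows in a topos\<close>

lemma HomD:
  assumes "f \<in> Hom C X Y"
  shows "f \<in> Arr C" "Dom C f = X" "Cod C f = Y"
  using assms by (auto simp: Hom_def)

text \<open>Typing conditions are stated by equations for \<open>Dom\<close> and \<open>Cod\<close>, so that the simplifier
  can discharge them.\<close>

context category
begin

declare Dom_Obj [simp] Cod_Obj [simp]

lemma Comp_typing [simp]:
  assumes "f \<in> Arr C" "g \<in> Arr C" "Cod C f = Dom C g"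
  shows "g \<cdot> f \<in> Arr C" "Dom C (g \<cdot> f) = Dom C f" "Cod C (g \<cdot> f) = Cod C g"
  using Comp_Hom[of f "Dom C f" "Dom C g" g "Cod C g"] assms by (auto simp: Hom_def)

lemma Idt_typing [simp]:
  assumes "X \<in> Obj C"
  shows "Idt C X \<in> Arr C" "Dom C (Idt C X) = X" "Cod C (Idt C X) = X"
  using Idt_Hom[OF assms] by (auto simp: Hom_def)

lemma Comp_Idt_simp [simp]: "f \<in> Arr C \<Longrightarrow> Dom C f = X \<Longrightarrow> f \<cdot> Idt C X = f"
  by (rule Comp_Idt) (auto simp: Hom_def)

lemma Idt_Comp_simp [simp]: "f \<in> Arr C \<Longrightarrow> Cod C f = X \<Longrightarrow> Idt C X \<cdot> f = f"
  by (rule Idt_Comp) (auto simp: Hom_def)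

lemma Comp_assoc_simp [simp]:
  "f \<in> Arr C \<Longrightarrow> g \<in> Arr C \<Longrightarrow> h \<in> Arr C \<Longrightarrow> Cod C f = Dom C g \<Longrightarrow> Cod C g = Dom C h \<Longrightarrow>
    (h \<cdot> g) \<cdot> f = h \<cdot> (g \<cdot> f)"
  by (rule Comp_assoc) (auto simp: Hom_def)

end

context topos
begin

declare One_Obj [simp] Omega_Obj [simp] Prod_Obj [simp] Inh_Obj [simp]

lemma bang_Hom: "X \<in> Obj E \<Longrightarrow> bang E X \<in> Hom E X (One E)"
  unfolding bang_def by (rule theI') (rule terminal)

lemma bang_typing [simp]:
  assumes "X \<in> Obj E"
  shows "bang E X \<in> Arr E" "Dom E (bang E X) = X" "Cod E (bang E X) = One E"
  using HomD[OF bang_Hom[OF assms]] by auto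

lemma to_One_eq: "u \<in> Hom E X (One E) \<Longrightarrow> v \<in> Hom E X (One E) \<Longrightarrow> u = v"
  using terminal Dom_Obj HomD by metis

lemma bang_comp [simp]:
  assumes "h \<in> Arr E" "Cod E h = X"
  shows "bang E X \<cdot> h = bang E (Dom E h)"
  by (rule to_One_eq[of _ "Dom E h"]) (use assms in \<open>auto simp: Hom_def\<close>)

lemma Tru_typing [simp]: "Tru E \<in> Arr E" "Dom E (Tru E) = One E" "Cod E (Tru E) = Omega E"
  using HomD[OF Tru_Hom] by auto

lemma proj_typing [simp]:
  assumes "X \<in> Obj E" "Y \<in> Obj E"
  shows "Fst E X Y \<in> Arr E" "Dom E (Fst E X Y) = X \<^bold>\<times> Y" "Cod E (Fst E X Y) = X"
    and "Snd E X Y \<in> Arr E" "Dom E (Snd E X Y) = X \<^bold>\<times> Y" "Cod E (Snd E X Y) = Y"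
  using HomD[OF Fst_Hom[OF assms]] HomD[OF Snd_Hom[OF assms]] by auto

lemma Ev_typing [simp]:
  assumes "X \<in> Obj E" "Y \<in> Obj E"
  shows "Ev E X Y \<in> Arr E" "Dom E (Ev E X Y) = Inh E X Y \<^bold>\<times> X" "Cod E (Ev E X Y) = Y"
  using HomD[OF Ev_Hom[OF assms]] by auto

section \<open>Pairings and product maps\<close>

lemma pairing_ex1:
  assumes "f \<in> Arr E" "g \<in> Arr E" "Dom E f = Dom E g"
  shows "\<exists>!h. h \<in> Hom E (Dom E f) (Cod E f \<^bold>\<times> Cod E g) \<and>
     Fst E (Cod E f) (Cod E g) \<cdot> h = f \<and> Snd E (Cod E f) (Cod E g) \<cdot> h = g"
  using assms by (intro product) (auto simp: Hom_def)

lemma pairing_spec: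
  assumes "f \<in> Arr E" "g \<in> Arr E" "Dom E f = Dom E g"
  shows "pairing E f g \<in> Hom E (Dom E f) (Cod E f \<^bold>\<times> Cod E g) \<and>
     Fst E (Cod E f) (Cod E g) \<cdot> pairing E f g = f \<and> Snd E (Cod E f) (Cod E g) \<cdot> pairing E f g = g"
  unfolding pairing_def by (rule theI') (rule pairing_ex1[OF assms])

lemma pairing_typing [simp]:
  assumes "f \<in> Arr E" "g \<in> Arr E" "Dom E f = Dom E g"
  shows "pairing E f g \<in> Arr E" "Dom E (pairing E f g) = Dom E g"
    "Cod E (pairing E f g) = Cod E f \<^bold>\<times> Cod E g"
  using pairing_spec[OF assms] assms by (auto simp: Hom_def)

lemma proj_pairing [simp]:
  assumes "f \<in> Arr E" "g \<in> Arr E" "Dom E f = Dom E g" "Cod E f = X" "Cod E g = Y"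
  shows "Fst E X Y \<cdot> pairing E f g = f" "Snd E X Y \<cdot> pairing E f g = g"
  using pairing_spec[of f g] assms by auto

lemma pairing_unique:
  assumes "h \<in> Arr E" "Cod E h = X \<^bold>\<times> Y" "X \<in> Obj E" "Y \<in> Obj E"
  shows "pairing E (Fst E X Y \<cdot> h) (Snd E X Y \<cdot> h) = h"
proof -
  let ?f = "Fst E X Y \<cdot> h" and ?g = "Snd E X Y \<cdot> h"
  have fg: "?f \<in> Hom E (Dom E h) X" "?g \<in> Hom E (Dom E h) Y"
    using assms by (simp_all add: Hom_def)
  have "h \<in> Hom E (Dom E h) (X \<^bold>\<times> Y)"
    using assms by (simp add: Hom_def)
  moreover have "pairing E ?f ?g \<in> Hom E (Dom E h) (X \<^bold>\<times> Y)"
    and "Fst E X Y \<cdot> pairing E ?f ?g = ?f" "Snd E X Y \<cdot> pairing E ?f ?g = ?g"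
    using HomD[OF fg(1)] HomD[OF fg(2)] by (simp_all add: Hom_def del: Comp_assoc_simp)
  ultimately show ?thesis using product[OF fg] by blast
qed

text \<open>Surjective pairing rebuilds the left side from its two projections, and these are
  \<open>f \<cdot> h\<close> and \<open>g \<cdot> h\<close>. As a rewrite rule this pushes
  substitutions into pairs, so composites with interpreted terms compute.\<close>

lemma pairing_comp [simp]:
  assumes "f \<in> Arr E" "g \<in> Arr E" "h \<in> Arr E" "Dom E f = Dom E g" "Cod E h = Dom E g"
  shows "pairing E f g \<cdot> h = pairing E (f \<cdot> h) (g \<cdot> h)"
proof -
  let ?X = "Cod E f" and ?Y = "Cod E g" and ?p = "pairing E f g"
  \<comment> \<open>Associativity is needed here from right to left, so that a projection meets the
    pairing. It is instantiated at \<open>h\<close> and \<open>?p\<close> and applied by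
    \<open>subst\<close>, because the simplifier uses the opposite orientation.\<close>
  note assoc = Comp_assoc_simp[symmetric, of h ?p]
  have "?p \<cdot> h = pairing E (Fst E ?X ?Y \<cdot> (?p \<cdot> h)) (Snd E ?X ?Y \<cdot> (?p \<cdot> h))"
    by (rule pairing_unique[symmetric]) (use assms in auto)
  also have "Fst E ?X ?Y \<cdot> (?p \<cdot> h) = f \<cdot> h"
    using assms by (subst assoc) auto
  also have "Snd E ?X ?Y \<cdot> (?p \<cdot> h) = g \<cdot> h"
    using assms by (subst assoc) auto
  finally show ?thesis .
qed

lemma pairing_proj [simp]:
  assumes "X \<in> Obj E" "Y \<in> Obj E"
  shows "pairing E (Fst E X Y) (Snd E X Y) = Idt E (X \<^bold>\<times> Y)"
  using pairing_unique[of "Idt E (X \<^bold>\<times> Y)" X Y] assms by simp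

lemma prod_map_typing [simp]:
  assumes "u \<in> Arr E" "v \<in> Arr E"
  shows "prod_map E u v \<in> Arr E" "Dom E (prod_map E u v) = Dom E u \<^bold>\<times> Dom E v"
    "Cod E (prod_map E u v) = Cod E u \<^bold>\<times> Cod E v"
  using assms by (auto simp: prod_map_def)

lemma prod_map_pairing [simp]:
  assumes "u \<in> Arr E" "v \<in> Arr E" "a \<in> Arr E" "b \<in> Arr E"
    and "Dom E a = Dom E b" "Cod E a = Dom E u" "Cod E b = Dom E v"
  shows "prod_map E u v \<cdot> pairing E a b = pairing E (u \<cdot> a) (v \<cdot> b)"
  using assms by (simp add: prod_map_def)

section \<open>Transposition and extensionality for internal homs\<close>

lemma uncurry_pairing:
  assumes "h \<in> Arr E" "a \<in> Arr E" "b \<in> Arr E" "X \<in> Obj E" "Y \<in> Obj E"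
    and "Cod E h = Inh E X Y" "Cod E a = Dom E h" "Cod E b = X" "Dom E a = Dom E b"
  shows "uncurry_arr E X Y h \<cdot> pairing E a b = Ev E X Y \<cdot> pairing E (h \<cdot> a) b"
  using assms by (simp add: uncurry_arr_def)

lemma curry_spec:
  assumes "f \<in> Arr E" "Dom E f = Z \<^bold>\<times> X" "Z \<in> Obj E" "X \<in> Obj E"
  shows "curry_arr E Z X f \<in> Hom E Z (Inh E X (Cod E f)) \<and>
    uncurry_arr E X (Cod E f) (curry_arr E Z X f) = f"
  unfolding curry_arr_def
  by (rule theI', rule exponential) (use assms in \<open>auto simp: Hom_def\<close>)

lemma curry_typing [simp]:
  assumes "f \<in> Arr E" "Dom E f = Z \<^bold>\<times> X" "Z \<in> Obj E" "X \<in> Obj E"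
  shows "curry_arr E Z X f \<in> Arr E" "Dom E (curry_arr E Z X f) = Z"
    "Cod E (curry_arr E Z X f) = Inh E X (Cod E f)"
  using curry_spec[OF assms] by (auto simp: Hom_def)

text \<open>The beta law at generalized elements: \<open>a\<close> instantiates the context and
  \<open>b\<close> the bound variable. As a simp rule it evaluates the interpretations of lambda
  terms.\<close>

lemma Ev_curry_comp [simp]:
  assumes "f \<in> Arr E" "Dom E f = Z \<^bold>\<times> X" "Z \<in> Obj E" "X \<in> Obj E" "Cod E f = Y"
    and "a \<in> Arr E" "b \<in> Arr E" "Dom E a = Dom E b" "Cod E a = Z" "Cod E b = X"
  shows "Ev E X Y \<cdot> pairing E (curry_arr E Z X f \<cdot> a) b = f \<cdot> pairing E a b"
  using curry_spec[of f Z X] uncurry_pairing[of "curry_arr E Z X f" a b X Y] assms by auto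

lemma Inh_eqI:
  assumes hk: "h \<in> Hom E Z (Inh E X Y)" "k \<in> Hom E Z (Inh E X Y)" and "X \<in> Obj E" "Y \<in> Obj E"
    and eq: "\<And>W a b. a \<in> Hom E W Z \<Longrightarrow> b \<in> Hom E W X \<Longrightarrow>
      Ev E X Y \<cdot> pairing E (h \<cdot> a) b = Ev E X Y \<cdot> pairing E (k \<cdot> a) b"
  shows "h = k"
proof -
  have Z: "Z \<in> Obj E" using hk Dom_Obj HomD by metis
  have unc: "uncurry_arr E X Y l = Ev E X Y \<cdot> pairing E (l \<cdot> Fst E Z X) (Snd E Z X)"
    if "l \<in> Hom E Z (Inh E X Y)" for l
    using that HomD[OF that] assms Z by (simp add: uncurry_arr_def prod_map_def)
  have "uncurry_arr E X Y h = uncurry_arr E X Y k"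
    unfolding unc[OF hk(1)] unc[OF hk(2)] by (rule eq) (auto intro: Fst_Hom Snd_Hom Z assms)
  moreover have "uncurry_arr E X Y k \<in> Hom E (Z \<^bold>\<times> X) Y"
    using HomD[OF hk(2)] Z assms by (auto simp: unc[OF hk(2)] Hom_def)
  ultimately show ?thesis
    using exponential[of X Y Z "uncurry_arr E X Y k"] hk Z assms by blast
qed


section \<open>Subobjects and Kripke--Joyal semantics\<close>

lemma monic_from_One:
  assumes "m \<in> Arr E" "Dom E m = One E"
  shows "monic E m"
  using assms to_One_eq unfolding monic_def by auto

text \<open>This turns truth into membership: a generalized element \<open>h\<close> satisfies
  \<open>c\<close> when it lies in the subobject \<open>m\<close>. A factorization comes from the
  universal property of the pullback; conversely \<open>c\<close> is true on \<open>m\<close>, and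
  truth is stable under precomposition. All forcing clauses below rest on it.\<close>

lemma classifies_iff:
  assumes c: "classifies E c m" and h: "h \<in> Hom E W (Cod E m)"
  shows "c \<cdot> h = Tru E \<cdot> bang E W \<longleftrightarrow> (\<exists>k. k \<in> Hom E W (Dom E m) \<and> m \<cdot> k = h)"
proof -
  have pb: "is_pullback E m (bang E (Dom E m)) c (Tru E)" and cH: "c \<in> Hom E (Cod E m) (Omega E)"
    using c by (auto simp: classifies_def)
  note [simp] = HomD[OF cH] HomD[OF h]
  have m [simp]: "m \<in> Arr E" and sq: "c \<cdot> m = Tru E \<cdot> bang E (Dom E m)"
    using pb by (auto simp: is_pullback_def Hom_def)
  have un: "\<exists>u. u \<in> Hom E W (Dom E m) \<and> m \<cdot> u = h"
    if "k \<in> Hom E W (One E)" "c \<cdot> h = Tru E \<cdot> k" for k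
  proof -
    have "h \<in> Hom E W (Dom E c)" "k \<in> Hom E W (Dom E (Tru E))" using h that by simp_all
    then show ?thesis using pb that(2) unfolding is_pullback_def by blast
  qed
  have W: "W \<in> Obj E" using Dom_Obj[of h] by simp
  show ?thesis
  proof
    assume "c \<cdot> h = Tru E \<cdot> bang E W"
    then show "\<exists>k. k \<in> Hom E W (Dom E m) \<and> m \<cdot> k = h"
      using un bang_Hom[OF W] by blast
  next
    assume "\<exists>k. k \<in> Hom E W (Dom E m) \<and> m \<cdot> k = h"
    then obtain k where k: "k \<in> Hom E W (Dom E m)" "m \<cdot> k = h" by blast
    have "c \<cdot> h = (c \<cdot> m) \<cdot> k" using HomD[OF k(1)] k(2) by simp
    also have "\<dots> = Tru E \<cdot> bang E W" unfolding sq using HomD[OF k(1)] by simp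
    finally show "c \<cdot> h = Tru E \<cdot> bang E W" .
  qed
qed

section \<open>Forcing clauses for equality and the universal quantifier\<close>

lemma classifies_char_arr: "monic E m \<Longrightarrow> classifies E (char_arr E m) m"
  unfolding char_arr_def by (rule theI') (rule classifier)

lemma char_arr_typing [simp]:
  assumes "monic E m"
  shows "char_arr E m \<in> Arr E" "Dom E (char_arr E m) = Cod E m" "Cod E (char_arr E m) = Omega E"
  using classifies_char_arr[OF assms] by (auto simp: classifies_def Hom_def)

text \<open>The first projection is a retraction of the diagonal.\<close>

lemma monic_diagonal: "Y \<in> Obj E \<Longrightarrow> monic E (pairing E (Idt E Y) (Idt E Y))"
  unfolding monic_def
proof (intro conjI allI ballI impI)
  fix W h k
  assume Y: "Y \<in> Obj E" and hk: "h \<in> Hom E W (Dom E (pairing E (Idt E Y) (Idt E Y)))"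
    "k \<in> Hom E W (Dom E (pairing E (Idt E Y) (Idt E Y)))"
    and eq: "pairing E (Idt E Y) (Idt E Y) \<cdot> h = pairing E (Idt E Y) (Idt E Y) \<cdot> k"
  note [simp] = Y HomD[OF hk(1)] HomD[OF hk(2)]
  have "Fst E Y Y \<cdot> pairing E h h = Fst E Y Y \<cdot> pairing E k k" using eq by simp
  then show "h = k" by simp
qed simp

lemma eq_arr_typing [simp]:
  assumes "Y \<in> Obj E"
  shows "eq_arr E Y \<in> Arr E" "Dom E (eq_arr E Y) = Y \<^bold>\<times> Y" "Cod E (eq_arr E Y) = Omega E"
  using assms monic_diagonal[OF assms] by (auto simp: eq_arr_def)

text \<open>By \<open>classifies_iff\<close>, truth of the equation means that the pair factors
  through the diagonal. The two projections then identify both components with the factor.\<close>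

lemma eq_arr_iff:
  assumes "a \<in> Hom E W Y" "b \<in> Hom E W Y"
  shows "eq_arr E Y \<cdot> pairing E a b = Tru E \<cdot> bang E W \<longleftrightarrow> a = b"
proof -
  note [simp] = HomD[OF assms(1)] HomD[OF assms(2)]
  have Y [simp]: "Y \<in> Obj E" using Cod_Obj[of a] by simp
  have "eq_arr E Y \<cdot> pairing E a b = Tru E \<cdot> bang E W \<longleftrightarrow>
      (\<exists>k. k \<in> Hom E W Y \<and> pairing E (Idt E Y) (Idt E Y) \<cdot> k = pairing E a b)"
    using classifies_iff[OF classifies_char_arr[OF monic_diagonal[OF Y]], of "pairing E a b" W]
    by (simp add: eq_arr_def Hom_def)
  also have "\<dots> \<longleftrightarrow> a = b"
  proof
    assume "\<exists>k. k \<in> Hom E W Y \<and> pairing E (Idt E Y) (Idt E Y) \<cdot> k = pairing E a b"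
    then obtain k where k: "k \<in> Hom E W Y" and eq: "pairing E k k = pairing E a b"
      by (auto simp: Hom_def)
    have "Fst E Y Y \<cdot> pairing E k k = a" "Snd E Y Y \<cdot> pairing E k k = b" by (simp_all add: eq)
    then show "a = b" using HomD[OF k] by simp
  next
    assume "a = b"
    then show "\<exists>k. k \<in> Hom E W Y \<and> pairing E (Idt E Y) (Idt E Y) \<cdot> k = pairing E a b"
      using assms by (intro exI[of _ a]) auto
  qed
  finally show ?thesis .
qed

lemma all_arr_typing [simp]:
  assumes "X \<in> Obj E"
  shows "all_arr E X \<in> Arr E" "Dom E (all_arr E X) = Inh E X (Omega E)" "Cod E (all_arr E X) = Omega E"
  using assms by (auto simp: all_arr_def monic_from_One)

text \<open>The Kripke--Joyal clause for the universal quantifier, with \<open>h\<close> as the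
  current assignment at stage \<open>W\<close>. Truth means that
  \<open>curry_arr E Z X q \<cdot> h\<close> is the constantly true predicate, and by extensionality
  this can be tested at all later stages \<open>V\<close> on all elements \<open>b\<close> of
  \<open>X\<close>.\<close>

lemma all_arr_iff:
  assumes q: "q \<in> Hom E (Z \<^bold>\<times> X) (Omega E)" and h: "h \<in> Hom E W Z" and X [simp]: "X \<in> Obj E"
  shows "all_arr E X \<cdot> curry_arr E Z X q \<cdot> h = Tru E \<cdot> bang E W \<longleftrightarrow>
    (\<forall>V. \<forall>a \<in> Hom E V W. \<forall>b \<in> Hom E V X. q \<cdot> pairing E (h \<cdot> a) b = Tru E \<cdot> bang E V)"
    (is "_ \<longleftrightarrow> ?R")
proof -
  note [simp] = HomD[OF q] HomD[OF h]
  have [simp]: "W \<in> Obj E" "Z \<in> Obj E" using Dom_Obj[of h] Cod_Obj[of h] by auto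
  let ?n = "curry_arr E (One E) X (Tru E \<cdot> bang E (One E \<^bold>\<times> X))"
  have "monic E ?n" by (rule monic_from_One) auto
  then have "all_arr E X \<cdot> (curry_arr E Z X q \<cdot> h) = Tru E \<cdot> bang E W \<longleftrightarrow>
      (\<exists>k. k \<in> Hom E W (One E) \<and> ?n \<cdot> k = curry_arr E Z X q \<cdot> h)"
    using classifies_iff[OF classifies_char_arr, of ?n "curry_arr E Z X q \<cdot> h" W]
    by (simp add: all_arr_def Hom_def)
  \<comment> \<open>The factor \<open>k\<close> has terminal codomain, so \<open>bang E W\<close> is
    the only candidate.\<close>
  also have "\<dots> \<longleftrightarrow> ?n \<cdot> bang E W = curry_arr E Z X q \<cdot> h"
    using bang_Hom[of W] to_One_eq by auto
  also have "\<dots> \<longleftrightarrow> ?R"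
  proof
    assume eq: "?n \<cdot> bang E W = curry_arr E Z X q \<cdot> h"
    show ?R
    proof (intro allI ballI)
      fix V a b assume a: "a \<in> Hom E V W" and b: "b \<in> Hom E V X"
      note [simp] = HomD[OF a] HomD[OF b]
      have "q \<cdot> pairing E (h \<cdot> a) b = Ev E X (Omega E) \<cdot> pairing E ((curry_arr E Z X q \<cdot> h) \<cdot> a) b"
        by simp
      also have "\<dots> = Ev E X (Omega E) \<cdot> pairing E ((?n \<cdot> bang E W) \<cdot> a) b"
        by (simp only: eq)
      also have "\<dots> = Tru E \<cdot> bang E V" using Dom_Obj[of a] by simp
      finally show "q \<cdot> pairing E (h \<cdot> a) b = Tru E \<cdot> bang E V" .
    qed
  next
    assume R: ?R
    show "?n \<cdot> bang E W = curry_arr E Z X q \<cdot> h"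
    proof (rule Inh_eqI[of _ W X "Omega E"])
      fix V a b assume a: "a \<in> Hom E V W" and b: "b \<in> Hom E V X"
      note [simp] = HomD[OF a] HomD[OF b]
      show "Ev E X (Omega E) \<cdot> pairing E ((?n \<cdot> bang E W) \<cdot> a) b =
          Ev E X (Omega E) \<cdot> pairing E ((curry_arr E Z X q \<cdot> h) \<cdot> a) b"
        using R a b Dom_Obj[of a] by simp
    qed (auto simp: Hom_def)
  qed
  finally show ?thesis .
qed

text \<open>The choice in \<open>subobject_arr\<close> needs a witness, which is the pullback of
  \<open>Tru E\<close> along \<open>c\<close>. It is monic because its other leg goes to the
  terminal object, so a mediating arrow is determined by its composite with \<open>p\<close>
  alone.\<close>

lemma subobject_arr_spec:
  assumes c: "c \<in> Hom E X (Omega E)"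
  shows "monic E (subobject_arr E c) \<and> classifies E c (subobject_arr E c)"
proof -
  obtain p q where pb: "is_pullback E p q c (Tru E)" using pullbacks[OF c Tru_Hom] by blast
  note [simp] = HomD[OF c]
  have p [simp]: "p \<in> Arr E" "Cod E p = X" and q: "q \<in> Hom E (Dom E p) (One E)"
    and sq: "c \<cdot> p = Tru E \<cdot> q"
    and un: "\<And>W h k. h \<in> Hom E W X \<Longrightarrow> k \<in> Hom E W (One E) \<Longrightarrow> c \<cdot> h = Tru E \<cdot> k \<Longrightarrow>
      \<exists>!u. u \<in> Hom E W (Dom E p) \<and> p \<cdot> u = h \<and> q \<cdot> u = k"
    using pb by (auto simp: is_pullback_def Hom_def)
  note [simp] = HomD[OF q]
  have qb: "q = bang E (Dom E p)" by (rule to_One_eq[OF q]) (simp add: bang_Hom)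
  have "monic E p"
    unfolding monic_def
  proof (intro conjI allI ballI impI)
    fix W h k assume hk: "h \<in> Hom E W (Dom E p)" "k \<in> Hom E W (Dom E p)" and eq: "p \<cdot> h = p \<cdot> k"
    note [simp] = HomD[OF hk(1)] HomD[OF hk(2)]
    have "c \<cdot> (p \<cdot> h) = (c \<cdot> p) \<cdot> h" by simp
    also have "\<dots> = Tru E \<cdot> (q \<cdot> h)" unfolding sq by simp
    finally have "\<exists>!u. u \<in> Hom E W (Dom E p) \<and> p \<cdot> u = p \<cdot> h \<and> q \<cdot> u = q \<cdot> h"
      by (intro un) (auto simp: Hom_def)
    \<comment> \<open>Now \<open>h\<close> and \<open>k\<close> mediate the same cone, so uniqueness
      identifies them.\<close>
    moreover have "q \<cdot> k = q \<cdot> h" by (rule to_One_eq[of _ W]) (auto simp: Hom_def)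
    ultimately show "h = k" using hk eq by metis
  qed simp
  moreover have "classifies E c p" using pb c qb by (auto simp: classifies_def)
  ultimately show ?thesis
    unfolding subobject_arr_def by (rule someI[where P = "\<lambda>m. monic E m \<and> classifies E c m", OF conjI])
qed

text \<open>Given one factorization, monicity supplies the uniqueness that the definite description
  in \<open>factor_through\<close> requires.\<close>

lemma factor_through_comp:
  assumes "monic E m" and k: "k \<in> Hom E W (Dom E m)" "m \<cdot> k = h" and h: "h \<in> Arr E" "Dom E h = W"
  shows "factor_through E m h \<in> Hom E W (Dom E m) \<and> m \<cdot> factor_through E m h = h"
proof -
  have "\<exists>!k. k \<in> Hom E (Dom E h) (Dom E m) \<and> m \<cdot> k = h"
    using assms unfolding monic_def by blast
  from theI'[OF this] show ?thesis using h unfolding factor_through_def by simp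
qed

text \<open>The clause \<open>all_arr_iff\<close> in terms of contexts: \<open>\<gamma>\<close>
  assigns values to the variables of \<open>\<Gamma>\<close> at stage \<open>W\<close>, and
  \<open>pairing E (\<gamma> \<cdot> a) b\<close> restricts it along \<open>a\<close> and extends it
  by the value \<open>b\<close> of the new variable.\<close>

lemma interp_TAll_iff:
  assumes "interp E ((x, X) # \<Gamma>) p \<in> Hom E (ctx_obj E \<Gamma> \<^bold>\<times> X) (Omega E)"
    and "\<gamma> \<in> Hom E W (ctx_obj E \<Gamma>)" "X \<in> Obj E"
  shows "interp E \<Gamma> (TAll x X p) \<cdot> \<gamma> = Tru E \<cdot> bang E W \<longleftrightarrow>
    (\<forall>V. \<forall>a \<in> Hom E V W. \<forall>b \<in> Hom E V X.
       interp E ((x, X) # \<Gamma>) p \<cdot> pairing E (\<gamma> \<cdot> a) b = Tru E \<cdot> bang E V)"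
proof -
  have "ctx_obj E \<Gamma> \<in> Obj E" using Cod_Obj[of \<gamma>] HomD[OF assms(2)] by auto
  then show ?thesis
    using all_arr_iff[OF assms] HomD[OF assms(1)] HomD[OF assms(2)] assms(3) by simp
qed

lemma interp_TAll_typing:
  assumes "interp E ((x, X) # \<Gamma>) p \<in> Hom E (ctx_obj E \<Gamma> \<^bold>\<times> X) (Omega E)"
    and "ctx_obj E \<Gamma> \<in> Obj E" "X \<in> Obj E"
  shows "interp E \<Gamma> (TAll x X p) \<in> Hom E (ctx_obj E \<Gamma>) (Omega E)"
  using HomD[OF assms(1)] assms(2,3) by (simp add: Hom_def)


section \<open>Internally additive maps\<close>

text \<open>Membership in the internally defined subobject is unfolded by
  \<open>classifies_iff\<close>, one forcing clause per quantifier, and \<open>eq_arr_iff\<close>.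
  Each quantifier introduces its own change of stage; merging the two changes leaves additivity at a
  single stage.\<close>

lemma add_incl_spec:
  assumes N: "abgrp_obj E N" and P: "abgrp_obj E P"
  shows add_incl_monic: "monic E (add_incl E N P)"
    and add_incl_Cod: "Cod E (add_incl E N P) = Inh E (gobj N) (gobj P)"
    and add_incl_factor: "h \<in> Hom E W (Inh E (gobj N) (gobj P)) \<Longrightarrow>
      (\<exists>k. k \<in> Hom E W (Dom E (add_incl E N P)) \<and> add_incl E N P \<cdot> k = h) \<longleftrightarrow>
      (\<forall>V. \<forall>a \<in> Hom E V W. \<forall>x \<in> Hom E V (gobj N). \<forall>y \<in> Hom E V (gobj N).
        Ev E (gobj N) (gobj P) \<cdot> pairing E (h \<cdot> a) (gadd N \<cdot> pairing E x y) =
        gadd P \<cdot> pairing E (Ev E (gobj N) (gobj P) \<cdot> pairing E (h \<cdot> a) x)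
                           (Ev E (gobj N) (gobj P) \<cdot> pairing E (h \<cdot> a) y))"
proof -
  define F where "F = Inh E (gobj N) (gobj P)"
  define ev where "ev = Ev E (gobj N) (gobj P)"
  have [simp]: "gobj N \<in> Obj E" "gobj P \<in> Obj E" "F \<in> Obj E"
    using N P by (auto simp: abgrp_obj_def F_def)
  have [simp]: "gadd N \<in> Arr E" "Dom E (gadd N) = gobj N \<^bold>\<times> gobj N" "Cod E (gadd N) = gobj N"
    "gadd P \<in> Arr E" "Dom E (gadd P) = gobj P \<^bold>\<times> gobj P" "Cod E (gadd P) = gobj P"
    using N P by (auto simp: abgrp_obj_def Hom_def)
  have [simp]: "ev \<in> Arr E" "Dom E ev = F \<^bold>\<times> gobj N" "Cod E ev = gobj P"
    by (simp_all add: ev_def F_def)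
  define ap where "ap t = TApp ev (TPair (TVar ''f'') t)" for t :: "('o, 'a) tm"
  define body where "body = TEq (ap (plus_tm N (TVar ''n'') (TVar ''k'')))
    (plus_tm P (ap (TVar ''n'')) (ap (TVar ''k'')))"
  define inner where "inner = TAll ''k'' (gobj N) body"
  define outer where "outer = TAll ''n'' (gobj N) inner"
  let ?\<Gamma>1 = "[(''f'', F)]"
  let ?\<Gamma>2 = "(''n'', gobj N) # ?\<Gamma>1"
  let ?\<Gamma>3 = "(''k'', gobj N) # ?\<Gamma>2"
  have incl: "add_incl E N P = subobject_arr E (arr1 E ''f'' F outer)"
    by (simp add: add_incl_def compr_def outer_def inner_def body_def ap_def F_def ev_def)
  have body_t: "interp E ?\<Gamma>3 body \<in> Hom E (ctx_obj E ?\<Gamma>2 \<^bold>\<times> gobj N) (Omega E)"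
    by (simp add: body_def ap_def Hom_def)
  have inner_t: "interp E ?\<Gamma>2 inner \<in> Hom E (ctx_obj E ?\<Gamma>1 \<^bold>\<times> gobj N) (Omega E)"
    using interp_TAll_typing[OF body_t] by (simp add: inner_def)
  have outer_t: "interp E ?\<Gamma>1 outer \<in> Hom E (ctx_obj E ?\<Gamma>1) (Omega E)"
    using interp_TAll_typing[OF inner_t] by (simp add: outer_def)
  have c: "arr1 E ''f'' F outer \<in> Hom E F (Omega E)"
    using HomD[OF outer_t] by (simp add: arr1_def Hom_def)
  note sub = subobject_arr_spec[OF c, folded incl]
  show "monic E (add_incl E N P)" using sub by blast
  show cod: "Cod E (add_incl E N P) = Inh E (gobj N) (gobj P)"
    using sub HomD[OF c] by (auto simp: classifies_def F_def Hom_def)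
  assume "h \<in> Hom E W (Inh E (gobj N) (gobj P))"
  then have h: "h \<in> Hom E W F" by (simp add: F_def)
  note [simp] = HomD[OF h]
  have [simp]: "W \<in> Obj E" using Dom_Obj[of h] by simp
  let ?\<gamma> = "pairing E (bang E W) h"
  have \<gamma>: "?\<gamma> \<in> Hom E W (ctx_obj E ?\<Gamma>1)" by (simp add: Hom_def)
  have "(\<exists>k. k \<in> Hom E W (Dom E (add_incl E N P)) \<and> add_incl E N P \<cdot> k = h) \<longleftrightarrow>
      arr1 E ''f'' F outer \<cdot> h = Tru E \<cdot> bang E W"
    using classifies_iff[of _ "add_incl E N P" h W] sub h cod by (simp add: F_def)
  also have "\<dots> \<longleftrightarrow> interp E ?\<Gamma>1 outer \<cdot> ?\<gamma> = Tru E \<cdot> bang E W"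
    using HomD[OF outer_t] by (simp add: arr1_def)
  also have "\<dots> \<longleftrightarrow> (\<forall>V. \<forall>a \<in> Hom E V W. \<forall>x \<in> Hom E V (gobj N).
       interp E ?\<Gamma>2 inner \<cdot> pairing E (?\<gamma> \<cdot> a) x = Tru E \<cdot> bang E V)"
    unfolding outer_def by (rule interp_TAll_iff[OF inner_t \<gamma>]) simp
  also have "\<dots> \<longleftrightarrow> (\<forall>V. \<forall>a \<in> Hom E V W. \<forall>x \<in> Hom E V (gobj N).
       \<forall>U. \<forall>b \<in> Hom E U V. \<forall>y \<in> Hom E U (gobj N).
        ev \<cdot> pairing E (h \<cdot> a \<cdot> b) (gadd N \<cdot> pairing E (x \<cdot> b) y) =
        gadd P \<cdot> pairing E (ev \<cdot> pairing E (h \<cdot> a \<cdot> b) (x \<cdot> b)) (ev \<cdot> pairing E (h \<cdot> a \<cdot> b) y))"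
  proof (intro all_cong1 ball_cong refl)
    fix V a x assume a: "a \<in> Hom E V W" and x: "x \<in> Hom E V (gobj N)"
    note [simp] = HomD[OF a] HomD[OF x]
    have [simp]: "V \<in> Obj E" using Dom_Obj[of a] by simp
    have \<delta>: "pairing E (?\<gamma> \<cdot> a) x \<in> Hom E V (ctx_obj E ?\<Gamma>2)" by (simp add: Hom_def)
    have "interp E ?\<Gamma>2 inner \<cdot> pairing E (?\<gamma> \<cdot> a) x = Tru E \<cdot> bang E V \<longleftrightarrow>
      (\<forall>U. \<forall>b \<in> Hom E U V. \<forall>y \<in> Hom E U (gobj N).
        interp E ?\<Gamma>3 body \<cdot> pairing E (pairing E (?\<gamma> \<cdot> a) x \<cdot> b) y = Tru E \<cdot> bang E U)"
      unfolding inner_def by (rule interp_TAll_iff[OF body_t \<delta>]) simp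
    also have "\<dots> \<longleftrightarrow> (\<forall>U. \<forall>b \<in> Hom E U V. \<forall>y \<in> Hom E U (gobj N).
        ev \<cdot> pairing E (h \<cdot> a \<cdot> b) (gadd N \<cdot> pairing E (x \<cdot> b) y) =
        gadd P \<cdot> pairing E (ev \<cdot> pairing E (h \<cdot> a \<cdot> b) (x \<cdot> b)) (ev \<cdot> pairing E (h \<cdot> a \<cdot> b) y))"
    proof (intro all_cong1 ball_cong refl)
      fix U b y assume b: "b \<in> Hom E U V" and y: "y \<in> Hom E U (gobj N)"
      note [simp] = HomD[OF b] HomD[OF y]
      have [simp]: "U \<in> Obj E" using Dom_Obj[of b] by simp
      let ?s = "ev \<cdot> pairing E (h \<cdot> a \<cdot> b) (gadd N \<cdot> pairing E (x \<cdot> b) y)"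
      let ?t = "gadd P \<cdot> pairing E (ev \<cdot> pairing E (h \<cdot> a \<cdot> b) (x \<cdot> b)) (ev \<cdot> pairing E (h \<cdot> a \<cdot> b) y)"
      have "interp E ?\<Gamma>3 body \<cdot> pairing E (pairing E (?\<gamma> \<cdot> a) x \<cdot> b) y = eq_arr E (gobj P) \<cdot> pairing E ?s ?t"
        by (simp add: body_def ap_def)
      then show "interp E ?\<Gamma>3 body \<cdot> pairing E (pairing E (?\<gamma> \<cdot> a) x \<cdot> b) y = Tru E \<cdot> bang E U \<longleftrightarrow> ?s = ?t"
        using eq_arr_iff[of ?s U "gobj P" ?t] by (simp add: Hom_def)
    qed
    finally show "interp E ?\<Gamma>2 inner \<cdot> pairing E (?\<gamma> \<cdot> a) x = Tru E \<cdot> bang E V \<longleftrightarrow> \<dots>" .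
  qed
  \<comment> \<open>The two stages are merged: from left to right the second change of stage is the
    identity; from right to left the single-stage law is used at \<open>a \<cdot> b\<close>,
    \<open>x \<cdot> b\<close> and \<open>y\<close>.\<close>
  also have "\<dots> \<longleftrightarrow> (\<forall>V. \<forall>a \<in> Hom E V W. \<forall>x \<in> Hom E V (gobj N). \<forall>y \<in> Hom E V (gobj N).
        ev \<cdot> pairing E (h \<cdot> a) (gadd N \<cdot> pairing E x y) =
        gadd P \<cdot> pairing E (ev \<cdot> pairing E (h \<cdot> a) x) (ev \<cdot> pairing E (h \<cdot> a) y))"
    (is "?L \<longleftrightarrow> ?R")
  proof
    assume L: ?L
    show ?R
    proof (intro allI ballI)
      fix V a x y assume a: "a \<in> Hom E V W" and x: "x \<in> Hom E V (gobj N)" and y: "y \<in> Hom E V (gobj N)"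
      have V: "V \<in> Obj E" using Dom_Obj[of a] HomD[OF a] by simp
      show "ev \<cdot> pairing E (h \<cdot> a) (gadd N \<cdot> pairing E x y) =
        gadd P \<cdot> pairing E (ev \<cdot> pairing E (h \<cdot> a) x) (ev \<cdot> pairing E (h \<cdot> a) y)"
        using L[rule_format, OF a x Idt_Hom[OF V] y] HomD[OF a] HomD[OF x] V by simp
    qed
  next
    assume R: ?R
    show ?L
      by (intro allI ballI R[rule_format]) (auto intro: Comp_Hom)
  qed
  finally show "(\<exists>k. k \<in> Hom E W (Dom E (add_incl E N P)) \<and> add_incl E N P \<cdot> k = h) \<longleftrightarrow>
      (\<forall>V. \<forall>a \<in> Hom E V W. \<forall>x \<in> Hom E V (gobj N). \<forall>y \<in> Hom E V (gobj N).
        Ev E (gobj N) (gobj P) \<cdot> pairing E (h \<cdot> a) (gadd N \<cdot> pairing E x y) =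
        gadd P \<cdot> pairing E (Ev E (gobj N) (gobj P) \<cdot> pairing E (h \<cdot> a) x)
                           (Ev E (gobj N) (gobj P) \<cdot> pairing E (h \<cdot> a) y))"
    by (simp only: ev_def)
qed

section \<open>Homomorphisms and the induced arrows on additive maps\<close>

lemma HomZ_carrierD:
  assumes "u \<in> carrier (HomZ E G H)"
  shows "u \<in> Hom E (gobj G) (gobj H)" "u \<cdot> gadd G = gadd H \<cdot> prod_map E u u"
  using assms by (auto simp: HomZ_def)

lemma Idt_HomZ: "abgrp_obj E G \<Longrightarrow> Idt E (gobj G) \<in> carrier (HomZ E G G)"
  by (auto simp: HomZ_def abgrp_obj_def Hom_def prod_map_def)

text \<open>Composing an additive map with the homomorphism \<open>u\<close> gives an additive map,
  so the lambda term in \<open>add_hom_map\<close> does factor through the inclusion for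
  \<open>Q\<close>. Only this makes \<open>factor_through\<close> meaningful; the evaluation rule is
  then the beta law.\<close>

lemma add_hom_map_spec:
  assumes N: "abgrp_obj E N" and P: "abgrp_obj E P" and Q: "abgrp_obj E Q"
    and u: "u \<in> carrier (HomZ E P Q)"
  shows "add_hom_map E N P Q u \<in> Hom E (Dom E (add_incl E N P)) (Dom E (add_incl E N Q))"
    and "z \<in> Hom E W (Dom E (add_incl E N P)) \<Longrightarrow> n \<in> Hom E W (gobj N) \<Longrightarrow>
      Ev E (gobj N) (gobj Q) \<cdot> pairing E (add_incl E N Q \<cdot> add_hom_map E N P Q u \<cdot> z) n =
      u \<cdot> Ev E (gobj N) (gobj P) \<cdot> pairing E (add_incl E N P \<cdot> z) n"
proof -
  define i where "i = add_incl E N P"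
  define j where "j = add_incl E N Q"
  define H where "H = Dom E i"
  have [simp]: "gobj N \<in> Obj E" "gobj P \<in> Obj E" "gobj Q \<in> Obj E"
    using N P Q by (auto simp: abgrp_obj_def)
  have [simp]: "gadd N \<in> Arr E" "Dom E (gadd N) = gobj N \<^bold>\<times> gobj N" "Cod E (gadd N) = gobj N"
    "gadd P \<in> Arr E" "Dom E (gadd P) = gobj P \<^bold>\<times> gobj P" "Cod E (gadd P) = gobj P"
    "gadd Q \<in> Arr E" "Dom E (gadd Q) = gobj Q \<^bold>\<times> gobj Q" "Cod E (gadd Q) = gobj Q"
    using N P Q by (auto simp: abgrp_obj_def Hom_def)
  note [simp] = HomD[OF HomZ_carrierD(1)[OF u]]
  have mi: "monic E i" and mj: "monic E j"
    using add_incl_monic N P Q by (auto simp: i_def j_def)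
  have i [simp]: "i \<in> Arr E" "Dom E i = H" "Cod E i = Inh E (gobj N) (gobj P)"
    using mi add_incl_Cod[OF N P] by (auto simp: monic_def H_def i_def)
  have j [simp]: "j \<in> Arr E" "Cod E j = Inh E (gobj N) (gobj Q)"
    using mj add_incl_Cod[OF N Q] by (auto simp: monic_def j_def)
  have [simp]: "H \<in> Obj E" using Dom_Obj[of i] by simp
  have iH: "i \<in> Hom E H (Inh E (gobj N) (gobj P))" by (simp add: Hom_def)
  \<comment> \<open>Postcomposition with \<open>u\<close> as an arrow into the full internal hom,
    before restriction to the additive maps.\<close>
  define h where "h = arr1 E ''f'' H (TLam ''n'' (gobj N)
    (TApp u (TApp (Ev E (gobj N) (gobj P)) (TPair (TApp i (TVar ''f'')) (TVar ''n'')))))"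
  have map_eq: "add_hom_map E N P Q u = factor_through E j h"
    by (simp add: add_hom_map_def h_def i_def j_def H_def Let_def)
  have hH: "h \<in> Hom E H (Inh E (gobj N) (gobj Q))"
    by (simp add: h_def arr1_def Hom_def)
  note [simp] = HomD[OF hH]
  have Ev_h: "Ev E (gobj N) (gobj Q) \<cdot> pairing E (h \<cdot> z) n =
      u \<cdot> Ev E (gobj N) (gobj P) \<cdot> pairing E (i \<cdot> z) n"
    if z: "z \<in> Hom E W H" and n: "n \<in> Hom E W (gobj N)" for z n W
    using HomD[OF z] HomD[OF n] Dom_Obj[of z] by (simp add: h_def arr1_def)
  have i_add: "Ev E (gobj N) (gobj P) \<cdot> pairing E (i \<cdot> a) (gadd N \<cdot> pairing E x y) =
        gadd P \<cdot> pairing E (Ev E (gobj N) (gobj P) \<cdot> pairing E (i \<cdot> a) x)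
                           (Ev E (gobj N) (gobj P) \<cdot> pairing E (i \<cdot> a) y)"
    if "a \<in> Hom E V H" "x \<in> Hom E V (gobj N)" "y \<in> Hom E V (gobj N)" for V a x y
  proof -
    \<comment> \<open>The inclusion is the generic additive map: it factors through itself, so the
      membership criterion yields its additivity.\<close>
    have "\<exists>k. k \<in> Hom E H (Dom E i) \<and> i \<cdot> k = i"
      by (rule exI[of _ "Idt E H"]) (simp add: Hom_def)
    then show ?thesis
      using add_incl_factor[OF N P iH] that unfolding i_def[symmetric] by blast
  qed
  have u_add: "u \<cdot> gadd P \<cdot> pairing E x y = gadd Q \<cdot> pairing E (u \<cdot> x) (u \<cdot> y)"
    if "x \<in> Hom E V (gobj P)" "y \<in> Hom E V (gobj P)" for V x y
  proof -
    note [simp] = HomD[OF that(1)] HomD[OF that(2)]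
    have "u \<cdot> gadd P \<cdot> pairing E x y = (u \<cdot> gadd P) \<cdot> pairing E x y" by simp
    then show ?thesis unfolding HomZ_carrierD(2)[OF u] by simp
  qed
  have "\<exists>k. k \<in> Hom E H (Dom E j) \<and> j \<cdot> k = h"
    unfolding j_def add_incl_factor[OF N Q hH]
  proof (intro allI ballI)
    fix V a x y assume a: "a \<in> Hom E V H" and x: "x \<in> Hom E V (gobj N)" and y: "y \<in> Hom E V (gobj N)"
    note [simp] = HomD[OF a] HomD[OF x] HomD[OF y]
    have xy: "gadd N \<cdot> pairing E x y \<in> Hom E V (gobj N)" by (simp add: Hom_def)
    show "Ev E (gobj N) (gobj Q) \<cdot> pairing E (h \<cdot> a) (gadd N \<cdot> pairing E x y) =
        gadd Q \<cdot> pairing E (Ev E (gobj N) (gobj Q) \<cdot> pairing E (h \<cdot> a) x)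
                           (Ev E (gobj N) (gobj Q) \<cdot> pairing E (h \<cdot> a) y)"
      unfolding Ev_h[OF a x] Ev_h[OF a y] Ev_h[OF a xy] i_add[OF a x y]
      by (rule u_add[of _ V]) (auto simp: Hom_def)
  qed
  then obtain k where k: "k \<in> Hom E H (Dom E j)" "j \<cdot> k = h" by blast
  have "add_hom_map E N P Q u \<in> Hom E H (Dom E j) \<and> j \<cdot> add_hom_map E N P Q u = h"
    unfolding map_eq by (rule factor_through_comp[OF mj k]) simp_all
  then have map_H: "add_hom_map E N P Q u \<in> Hom E H (Dom E j)"
    and j_map: "j \<cdot> add_hom_map E N P Q u = h" by blast+
  show "add_hom_map E N P Q u \<in> Hom E (Dom E (add_incl E N P)) (Dom E (add_incl E N Q))"
    using map_H by (simp add: H_def i_def j_def)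
  assume "z \<in> Hom E W (Dom E (add_incl E N P))" and n: "n \<in> Hom E W (gobj N)"
  then have z: "z \<in> Hom E W H" by (simp add: H_def i_def)
  have "j \<cdot> add_hom_map E N P Q u \<cdot> z = h \<cdot> z"
    using HomD[OF map_H] HomD[OF z] by (simp flip: j_map)
  then show "Ev E (gobj N) (gobj Q) \<cdot> pairing E (add_incl E N Q \<cdot> add_hom_map E N P Q u \<cdot> z) n =
      u \<cdot> Ev E (gobj N) (gobj P) \<cdot> pairing E (add_incl E N P \<cdot> z) n"
    using Ev_h[OF z n] by (simp add: i_def j_def)
qed


section \<open>Homomorphisms out of the tensor product\<close>

lemma tensor_unit_Hom:
  assumes "is_tensor E A M N T \<Phi>" "abgrp_obj E P" "f \<in> carrier (HomZ E T P)"
  shows "\<Phi> P f \<in> Hom E (gobj M) (Dom E (add_incl E N P))"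
proof -
  have "\<Phi> P f \<in> carrier (HomA E A M (add_hom E A N P))"
    using assms by (auto simp: is_tensor_def iso_def hom_def)
  then show ?thesis by (auto simp: HomA_def HomZ_def add_hom_def Let_def)
qed

lemma tensor_arr_Hom:
  assumes N: "abgrp_obj E N" and T: "is_tensor E A M N T \<Phi>"
  shows "tensor_arr E N T \<Phi> \<in> Hom E (gobj M \<^bold>\<times> gobj N) (gobj T)"
proof -
  have aT: "abgrp_obj E T" using T by (simp add: is_tensor_def)
  have [simp]: "gobj N \<in> Obj E" "gobj T \<in> Obj E" using N aT by (auto simp: abgrp_obj_def)
  have "add_incl E N T \<in> Arr E" using add_incl_monic[OF N aT] by (simp add: monic_def)
  then show ?thesis
    using HomD[OF tensor_unit_Hom[OF T aT Idt_HomZ[OF aT]]] add_incl_Cod[OF N aT]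
    by (simp add: tensor_arr_def uncurry_arr_def Hom_def)
qed

text \<open>A Yoneda argument, stated on generalized elements \<open>a\<close> and \<open>b\<close>:
  naturality at the identity of \<open>T\<close> expresses \<open>\<Phi> P f\<close> through the
  unit, and \<open>add_hom_map_spec\<close> moves \<open>f\<close> outside the evaluation.\<close>

lemma tensor_arr_transpose:
  assumes N: "abgrp_obj E N" and P: "abgrp_obj E P" and T: "is_tensor E A M N T \<Phi>"
    and f: "f \<in> carrier (HomZ E T P)" and a: "a \<in> Hom E V (gobj M)" and b: "b \<in> Hom E V (gobj N)"
  shows "f \<cdot> tensor_arr E N T \<Phi> \<cdot> pairing E a b =
    Ev E (gobj N) (gobj P) \<cdot> pairing E (add_incl E N P \<cdot> \<Phi> P f \<cdot> a) b"
proof -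
  have aT: "abgrp_obj E T" using T by (simp add: is_tensor_def)
  have [simp]: "gobj N \<in> Obj E" "gobj T \<in> Obj E" "gobj P \<in> Obj E"
    using N aT P by (auto simp: abgrp_obj_def)
  define \<eta> where "\<eta> = \<Phi> T (Idt E (gobj T))"
  have \<eta>: "\<eta> \<in> Hom E (gobj M) (Dom E (add_incl E N T))"
    unfolding \<eta>_def by (rule tensor_unit_Hom[OF T aT Idt_HomZ[OF aT]])
  have [simp]: "add_incl E N T \<in> Arr E" "Cod E (add_incl E N T) = Inh E (gobj N) (gobj T)"
    using add_incl_monic[OF N aT] add_incl_Cod[OF N aT] by (auto simp: monic_def)
  note [simp] = HomD[OF \<eta>] HomD[OF a] HomD[OF b] HomD[OF HomZ_carrierD(1)[OF f]]
    HomD[OF add_hom_map_spec(1)[OF N aT P f]]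
  \<comment> \<open>Naturality of \<open>\<Phi>\<close> for the homomorphism \<open>f\<close> from
    \<open>T\<close> to \<open>P\<close>, applied to the identity of \<open>T\<close>.\<close>
  have "\<Phi> P (f \<cdot> Idt E (gobj T)) = add_hom_map E N T P f \<cdot> \<eta>"
    using T aT P f Idt_HomZ[OF aT] by (simp only: is_tensor_def \<eta>_def)
  then have \<Phi>f: "\<Phi> P f \<cdot> a = add_hom_map E N T P f \<cdot> \<eta> \<cdot> a" by simp
  have "tensor_arr E N T \<Phi> \<cdot> pairing E a b =
      Ev E (gobj N) (gobj T) \<cdot> pairing E (add_incl E N T \<cdot> \<eta> \<cdot> a) b"
    unfolding tensor_arr_def \<eta>_def[symmetric]
    using uncurry_pairing[of "add_incl E N T \<cdot> \<eta>" a b "gobj N" "gobj T"] by simp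
  then show ?thesis
    unfolding \<Phi>f using add_hom_map_spec(2)[OF N aT P f Comp_Hom[OF a \<eta>] b] by simp
qed

text \<open>Three cancellations in turn: \<open>Inh_eqI\<close> removes the evaluation, monicity
  removes the inclusion, and bijectivity of \<open>\<Phi> P\<close> gives
  \<open>f = g\<close>.\<close>

lemma tensor_hom_eqI:
  fixes P :: "('o, 'a) abgrp"
  assumes N: "abgrp_obj E N" and P: "abgrp_obj E P" and T: "is_tensor E A M N T \<Phi>"
    and f: "f \<in> carrier (HomZ E T P)" and g: "g \<in> carrier (HomZ E T P)"
    and eq: "\<And>V a b. a \<in> Hom E V (gobj M) \<Longrightarrow> b \<in> Hom E V (gobj N) \<Longrightarrow>
      f \<cdot> tensor_arr E N T \<Phi> \<cdot> pairing E a b = g \<cdot> tensor_arr E N T \<Phi> \<cdot> pairing E a b"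
  shows "f = g"
proof -
  have obj: "gobj N \<in> Obj E" "gobj P \<in> Obj E" using N P by (auto simp: abgrp_obj_def)
  have mono: "monic E (add_incl E N P)" by (rule add_incl_monic[OF N P])
  then have iH: "add_incl E N P \<in> Hom E (Dom E (add_incl E N P)) (Inh E (gobj N) (gobj P))"
    using add_incl_Cod[OF N P] by (simp add: monic_def Hom_def)
  note \<Phi>H = tensor_unit_Hom[OF T P f] tensor_unit_Hom[OF T P g]
  have "add_incl E N P \<cdot> \<Phi> P f = add_incl E N P \<cdot> \<Phi> P g"
  proof (rule Inh_eqI[OF Comp_Hom[OF \<Phi>H(1) iH] Comp_Hom[OF \<Phi>H(2) iH] obj])
    fix W a b assume a: "a \<in> Hom E W (gobj M)" and b: "b \<in> Hom E W (gobj N)"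
    show "Ev E (gobj N) (gobj P) \<cdot> pairing E ((add_incl E N P \<cdot> \<Phi> P f) \<cdot> a) b =
        Ev E (gobj N) (gobj P) \<cdot> pairing E ((add_incl E N P \<cdot> \<Phi> P g) \<cdot> a) b"
      using eq[OF a b] tensor_arr_transpose[OF N P T f a b] tensor_arr_transpose[OF N P T g a b]
        Comp_assoc[OF a \<Phi>H(1) iH] Comp_assoc[OF a \<Phi>H(2) iH] by simp
  qed
  then have "\<Phi> P f = \<Phi> P g" using mono \<Phi>H unfolding monic_def by blast
  moreover have "inj_on (\<Phi> P) (carrier (HomZ E T P))"
    using T P by (auto simp: is_tensor_def iso_def bij_betw_def)
  ultimately show ?thesis using f g by (auto dest: inj_onD)
qed

text \<open>Validity is forcing at the stage \<open>One E\<close>, so two quantifier clauses and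
  \<open>eq_arr_iff\<close> unfold the formula. Since \<open>x \<noteq> y\<close>, the inner binder
  does not shadow the outer one and the two variables denote independent elements.\<close>

lemma valid_all_all_eq_iff:
  assumes t: "t \<in> Hom E (X \<^bold>\<times> Y) Z" and f: "f \<in> Hom E Z Q" and g: "g \<in> Hom E Z Q"
    and [simp]: "X \<in> Obj E" "Y \<in> Obj E" and xy: "x \<noteq> y"
  shows "valid E (TAll x X (TAll y Y
      (TEq (TApp f (TApp t (TPair (TVar x) (TVar y)))) (TApp g (TApp t (TPair (TVar x) (TVar y))))))) \<longleftrightarrow>
    (\<forall>V. \<forall>a \<in> Hom E V X. \<forall>b \<in> Hom E V Y. f \<cdot> t \<cdot> pairing E a b = g \<cdot> t \<cdot> pairing E a b)"
proof -
  note [simp] = HomD[OF t] HomD[OF f] HomD[OF g] xy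
  have [simp]: "Q \<in> Obj E" using Cod_Obj[of f] by simp
  define s where "s = TPair (TVar x) (TVar y :: ('o, 'a) tm)"
  define body where "body = TEq (TApp f (TApp t s)) (TApp g (TApp t s))"
  define inner where "inner = TAll y Y body"
  let ?\<Gamma>1 = "[(x, X)]"
  let ?\<Gamma>2 = "(y, Y) # ?\<Gamma>1"
  have body_t: "interp E ?\<Gamma>2 body \<in> Hom E (ctx_obj E ?\<Gamma>1 \<^bold>\<times> Y) (Omega E)"
    by (simp add: body_def s_def Hom_def)
  have inner_t: "interp E ?\<Gamma>1 inner \<in> Hom E (ctx_obj E [] \<^bold>\<times> X) (Omega E)"
    using interp_TAll_typing[OF body_t] by (simp add: inner_def)
  have outer_t: "interp E [] (TAll x X inner) \<in> Hom E (ctx_obj E []) (Omega E)"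
    using interp_TAll_typing[OF inner_t] by simp
  \<comment> \<open>\<open>valid\<close> compares an interpretation directly with
    \<open>Tru E\<close>, while the quantifier clause expects composites with an assignment and with
    \<open>bang\<close>. At the empty context both can be taken to be the identity of
    \<open>One E\<close>.\<close>
  have bang_One: "bang E (One E) = Idt E (One E)"
    by (rule to_One_eq[of _ "One E"]) (auto simp: bang_Hom Idt_Hom)
  have "valid E (TAll x X inner) \<longleftrightarrow>
      interp E [] (TAll x X inner) \<cdot> Idt E (One E) = Tru E \<cdot> bang E (One E)"
    using HomD[OF outer_t] by (simp add: valid_def bang_One del: interp.simps)
  also have "\<dots> \<longleftrightarrow> (\<forall>V. \<forall>a \<in> Hom E V (One E). \<forall>b \<in> Hom E V X.
       interp E ?\<Gamma>1 inner \<cdot> pairing E (Idt E (One E) \<cdot> a) b = Tru E \<cdot> bang E V)"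
    by (rule interp_TAll_iff[OF inner_t]) (auto simp: Idt_Hom)
  also have "\<dots> \<longleftrightarrow> (\<forall>V. \<forall>a \<in> Hom E V (One E). \<forall>b \<in> Hom E V X. \<forall>U. \<forall>c \<in> Hom E U V. \<forall>d \<in> Hom E U Y.
       f \<cdot> t \<cdot> pairing E (b \<cdot> c) d = g \<cdot> t \<cdot> pairing E (b \<cdot> c) d)"
  proof (intro all_cong1 ball_cong refl)
    fix V a b assume a: "a \<in> Hom E V (One E)" and b: "b \<in> Hom E V X"
    note [simp] = HomD[OF a] HomD[OF b]
    let ?\<gamma> = "pairing E (Idt E (One E) \<cdot> a) b"
    have \<gamma>: "?\<gamma> \<in> Hom E V (ctx_obj E ?\<Gamma>1)" by (simp add: Hom_def)
    have "interp E ?\<Gamma>1 inner \<cdot> ?\<gamma> = Tru E \<cdot> bang E V \<longleftrightarrow>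
        (\<forall>U. \<forall>c \<in> Hom E U V. \<forall>d \<in> Hom E U Y.
          interp E ?\<Gamma>2 body \<cdot> pairing E (?\<gamma> \<cdot> c) d = Tru E \<cdot> bang E U)"
      unfolding inner_def by (rule interp_TAll_iff[OF body_t \<gamma>]) simp
    also have "\<dots> \<longleftrightarrow> (\<forall>U. \<forall>c \<in> Hom E U V. \<forall>d \<in> Hom E U Y.
        f \<cdot> t \<cdot> pairing E (b \<cdot> c) d = g \<cdot> t \<cdot> pairing E (b \<cdot> c) d)"
    proof (intro all_cong1 ball_cong refl)
      fix U c d assume c: "c \<in> Hom E U V" and d: "d \<in> Hom E U Y"
      note [simp] = HomD[OF c] HomD[OF d]
      have "interp E ?\<Gamma>2 body \<cdot> pairing E (?\<gamma> \<cdot> c) d =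
          eq_arr E Q \<cdot> pairing E (f \<cdot> t \<cdot> pairing E (b \<cdot> c) d) (g \<cdot> t \<cdot> pairing E (b \<cdot> c) d)"
        by (simp add: body_def s_def)
      then show "interp E ?\<Gamma>2 body \<cdot> pairing E (?\<gamma> \<cdot> c) d = Tru E \<cdot> bang E U \<longleftrightarrow>
          f \<cdot> t \<cdot> pairing E (b \<cdot> c) d = g \<cdot> t \<cdot> pairing E (b \<cdot> c) d"
        by (simp add: eq_arr_iff Hom_def)
    qed
    finally show "interp E ?\<Gamma>1 inner \<cdot> ?\<gamma> = Tru E \<cdot> bang E V \<longleftrightarrow> \<dots>" .
  qed
  \<comment> \<open>The element of \<open>One E\<close> always exists and carries no information;
    the stages \<open>V\<close> and \<open>U\<close> are merged through the identity one way and by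
    composition with \<open>c\<close> the other.\<close>
  also have "\<dots> \<longleftrightarrow> (\<forall>V. \<forall>a \<in> Hom E V X. \<forall>b \<in> Hom E V Y.
      f \<cdot> t \<cdot> pairing E a b = g \<cdot> t \<cdot> pairing E a b)" (is "?L \<longleftrightarrow> ?R")
  proof
    assume L: ?L
    show ?R
    proof (intro allI ballI)
      fix V a b assume a: "a \<in> Hom E V X" and b: "b \<in> Hom E V Y"
      have V: "V \<in> Obj E" using Dom_Obj[of a] HomD[OF a] by simp
      show "f \<cdot> t \<cdot> pairing E a b = g \<cdot> t \<cdot> pairing E a b"
        using L[rule_format, OF bang_Hom[OF V] a Idt_Hom[OF V] b] HomD[OF a] by simp
    qed
  next
    assume R: ?R
    show ?L
      by (intro allI ballI R[rule_format]) (auto intro: Comp_Hom)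
  qed
  finally show ?thesis by (simp only: inner_def body_def s_def)
qed

end

theorem propositionC7:
  fixes E :: "('o, 'a) topos_data"
    and A :: "('o, 'a) ringo" and M N :: "('o, 'a) modo" and P T :: "('o, 'a) abgrp"
    and \<Phi> :: "('o, 'a) abgrp \<Rightarrow> 'a \<Rightarrow> 'a" and f g :: 'a
  assumes "topos E"
    and "\<forall>A' M' N'. ring_obj E A' \<and> right_module E A' M' \<and> left_module E A' N' \<longrightarrow>
           (\<exists>T' \<Phi>'. is_tensor E A' M' N' T' \<Phi>')"
    and "ring_obj E A" and "right_module E A M" and "left_module E A N" and "abgrp_obj E P"
    and "is_tensor E A M N T \<Phi>"
    and "f \<in> carrier (HomZ E T P)" and "g \<in> carrier (HomZ E T P)"
  shows "f = g \<longleftrightarrow>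
    valid E (TAll ''m'' (gobj M) (TAll ''n'' (gobj N)
      (let m_tensor_n = TApp (tensor_arr E N T \<Phi>) (TPair (TVar ''m'') (TVar ''n''))
       in TEq (TApp f m_tensor_n) (TApp g m_tensor_n))))"
proof -
  interpret topos E by fact
  have N: "abgrp_obj E N" and M: "abgrp_obj E M"
    using assms by (auto simp: left_module_def right_module_def)
  then have obj: "gobj M \<in> Obj E" "gobj N \<in> Obj E" by (auto simp: abgrp_obj_def)
  have "''m'' \<noteq> ''n''" by simp
  note valid_iff = valid_all_all_eq_iff[OF tensor_arr_Hom[OF N assms(7)]
      HomZ_carrierD(1)[OF assms(8)] HomZ_carrierD(1)[OF assms(9)] obj this]
  \<comment> \<open>After unfolding validity, the forward direction is substitution and the converse
    is \<open>tensor_hom_eqI\<close>.\<close>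
  show ?thesis
    unfolding Let_def valid_iff using tensor_hom_eqI[OF N assms(6-9)] by blast
qed

end
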